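(* Let $\mathcal C=(C,G,\delta)$ be a crossed module of groupoids with object set $X$. Let $M_2(\mathcal C)$ be the group of sections $s_2:X\to C$ of $\beta$ under pointwise addition. Then there is a crossed module (of groups) $$\zeta: M_2(\mathcal C)\to FDer^*(\mathcal C),$$ where $\zeta$ is defined by $s_2\mapsto(\delta s_2,s_1)$ with $s_1:a\mapsto -s_2(\alpha a)^a+s_2(\beta a)$ for $a\in G$, and the action of $FDer^*(\mathcal C)$ on $M_2(\mathcal C)$ is given by $$(s_2)^{(t_0,t_1)}:x\mapsto s_2(\alpha t_0(x))^{t_0(x)}\qquad(x\in X).$$
   Context: Conventions: the source and target maps of a groupoid are $\alpha,\beta$; composition is written additively, $a+b$ being defined when $\beta a=\alpha b$; $-a$ is the inverse of $a$; $G(x,y)$ is the set of $a\in G$ with $\alpha a=x$, $\beta a=y$. A groupoid is totally intransitive if $\alpha=\beta$. Action: if $G,C$ are groupoids over the same object set and $C$ is totally intransitive, an action of $G$ on $C$ is a partial function $(c,a)\mapsto c^a$, defined iff $\beta(c)=\alpha(a)$, with $\beta(c^a)=\beta(a)$, $(c_1+c_2)^a=c_1^a+c_2^a$, $c^{a+b}=(c^a)^b$, and $c^{e_x}=c$ for identities $e_x$. A crossed module of groupoids $\mathcal C=(C,G,\delta)$ consists of groupoids $C,G$ over the same object set $X$ with $C$ totally intransitive, a groupoid morphism $\delta:C\to G$ which is the identity on objects, and an action of $G$ on $C$ with $\delta(c^a)=-a+\delta c+a$ and $c^{\delta c_1}=-c_1+c+c_1$ for $c,c_1\in C(x,x)$,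 $a\in G(x,y)$. A crossed module of groups is the case of one object: a homomorphism $\mu:M\to P$ and a right action of $P$ on $M$ by automorphisms with $\mu(m^p)=p^{-1}\mu(m)p$ and $m^{\mu(m')}=m'^{-1}mm'$ (in multiplicative notation). A free derivation on $\mathcal C$ is a pair $s=(s_0,s_1)$ of functions $s_0:X\to G$, $s_1:G\to C$ such that $\beta(s_0x)=x$, $\beta(s_1a)=\beta a$, and $s_1(a+b)=s_1(a)^b+s_1(b)$ whenever $a+b$ is defined. $FDer(\mathcal C)$ is the set of free derivations. For a free derivation $t$ put $g_0(x)=\alpha t_0(x)$, $g_1(a)=t_0(\alpha a)+a+\delta t_1(a)-t_0(\beta a)$. $FDer(\mathcal C)$ is a monoid under $(s*t)_0(x)=s_0(g_0(x))+t_0(x)$ for $x\in X$, $(s*t)_1(a)=t_1(a)+(s_1(g_1(a)))^{t_0(\beta a)}$ for $a\in G$; its identity has $s_0(x)$ the identity at $x$ and $s_1(a)$ the identity of $C$ at $\beta a$. $FDer^*(\mathcal C)$ is its group of invertible elements. *)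

theory Defs
  imports "HOL-Algebra.Group"
begin

section \<open>Groupoids\<close>

record ('x, 'a) groupoid_data =
  obj :: "'x set"
  arr :: "'a set"
  src :: "'a \<Rightarrow> 'x"
  tgt :: "'a \<Rightarrow> 'x"
  gplus :: "'a \<Rightarrow> 'a \<Rightarrow> 'a"  (infixl "\<boxplus>\<index>" 65)
  gid :: "'x \<Rightarrow> 'a"

text \<open>
  Composition is a total function of the logic; it is constrained, and used, only on pairs
  with \<open>tgt G a = src G b\<close>.  It is written in diagrammatic order.
\<close>

locale groupoid =
  fixes G :: "('x, 'a) groupoid_data" (structure)
  assumes src_obj: "a \<in> arr G \<Longrightarrow> src G a \<in> obj G"
    and tgt_obj: "a \<in> arr G \<Longrightarrow> tgt G a \<in> obj G"
    and gid_arr: "x \<in> obj G \<Longrightarrow> gid G x \<in> arr G"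
    and src_gid: "x \<in> obj G \<Longrightarrow> src G (gid G x) = x"
    and tgt_gid: "x \<in> obj G \<Longrightarrow> tgt G (gid G x) = x"
    and gplus_arr: "\<lbrakk>a \<in> arr G; b \<in> arr G; tgt G a = src G b\<rbrakk> \<Longrightarrow> a \<boxplus> b \<in> arr G"
    and src_gplus: "\<lbrakk>a \<in> arr G; b \<in> arr G; tgt G a = src G b\<rbrakk> \<Longrightarrow> src G (a \<boxplus> b) = src G a"
    and tgt_gplus: "\<lbrakk>a \<in> arr G; b \<in> arr G; tgt G a = src G b\<rbrakk> \<Longrightarrow> tgt G (a \<boxplus> b) = tgt G b"
    and gplus_assoc: "\<lbrakk>a \<in> arr G; b \<in> arr G; c \<in> arr G; tgt G a = src G b; tgt G b = src G c\<rbrakk>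
          \<Longrightarrow> (a \<boxplus> b) \<boxplus> c = a \<boxplus> (b \<boxplus> c)"
    and gid_left: "a \<in> arr G \<Longrightarrow> gid G (src G a) \<boxplus> a = a"
    and gid_right: "a \<in> arr G \<Longrightarrow> a \<boxplus> gid G (tgt G a) = a"
    and inverse_ex: "a \<in> arr G \<Longrightarrow> \<exists>b\<in>arr G. src G b = tgt G a \<and> tgt G b = src G a \<and>
          a \<boxplus> b = gid G (src G a) \<and> b \<boxplus> a = gid G (tgt G a)"

definition gneg :: "('x, 'a) groupoid_data \<Rightarrow> 'a \<Rightarrow> 'a"  ("\<boxminus>\<index> _" [81] 80) where
  "gneg G a = (THE b. b \<in> arr G \<and> src G b = tgt G a \<and> tgt G b = src G a \<and>
     a \<boxplus>\<^bsub>G\<^esub> b = gid G (src G a) \<and> b \<boxplus>\<^bsub>G\<^esub> a = gid G (tgt G a))"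

definition totally_intransitive :: "('x, 'a) groupoid_data \<Rightarrow> bool" where
  "totally_intransitive C \<longleftrightarrow> (\<forall>c\<in>arr C. src C c = tgt C c)"

text \<open>Morphisms of groupoids over the same object set that are the identity on objects.\<close>

locale groupoid_morphism_over =
  dom: groupoid C + cod: groupoid G
  for C :: "('x, 'c) groupoid_data" and G :: "('x, 'g) groupoid_data" +
  fixes \<delta> :: "'c \<Rightarrow> 'g"
  assumes same_obj: "obj C = obj G"
    and map_arr: "c \<in> arr C \<Longrightarrow> \<delta> c \<in> arr G"
    and map_src: "c \<in> arr C \<Longrightarrow> src G (\<delta> c) = src C c"
    and map_tgt: "c \<in> arr C \<Longrightarrow> tgt G (\<delta> c) = tgt C c"
    and map_gid: "x \<in> obj C \<Longrightarrow> \<delta> (gid C x) = gid G x"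
    and map_gplus: "\<lbrakk>c \<in> arr C; d \<in> arr C; tgt C c = src C d\<rbrakk>
          \<Longrightarrow> \<delta> (c \<boxplus>\<^bsub>C\<^esub> d) = \<delta> c \<boxplus>\<^bsub>G\<^esub> \<delta> d"

text \<open>
  \<open>act c a\<close> is the element written \<open>c\<close> to the power \<open>a\<close>.  The action is partial: \<open>act c a\<close>
  is constrained, and used, only if \<open>tgt C c = src G a\<close>.
\<close>

locale groupoid_action =
  C: groupoid C + G: groupoid G
  for C :: "('x, 'c) groupoid_data" and G :: "('x, 'g) groupoid_data" +
  fixes act :: "'c \<Rightarrow> 'g \<Rightarrow> 'c"
  assumes act_obj: "obj C = obj G"
    and act_intransitive: "totally_intransitive C"
    and act_arr: "\<lbrakk>c \<in> arr C; a \<in> arr G; tgt C c = src G a\<rbrakk> \<Longrightarrow> act c a \<in> arr C"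
    and act_tgt: "\<lbrakk>c \<in> arr C; a \<in> arr G; tgt C c = src G a\<rbrakk> \<Longrightarrow> tgt C (act c a) = tgt G a"
    and act_gplus: "\<lbrakk>c \<in> arr C; d \<in> arr C; a \<in> arr G; tgt C c = src C d; tgt C d = src G a\<rbrakk>
          \<Longrightarrow> act (c \<boxplus>\<^bsub>C\<^esub> d) a = act c a \<boxplus>\<^bsub>C\<^esub> act d a"
    and act_act: "\<lbrakk>c \<in> arr C; a \<in> arr G; b \<in> arr G; tgt C c = src G a; tgt G a = src G b\<rbrakk>
          \<Longrightarrow> act c (a \<boxplus>\<^bsub>G\<^esub> b) = act (act c a) b"
    and act_gid: "c \<in> arr C \<Longrightarrow> act c (gid G (tgt C c)) = c"


section \<open>Crossed modules\<close>

locale crossed_module_groupoids =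
  groupoid_morphism_over C G \<delta> + groupoid_action C G act
  for C :: "('x, 'c) groupoid_data" and G :: "('x, 'g) groupoid_data"
    and \<delta> :: "'c \<Rightarrow> 'g" and act :: "'c \<Rightarrow> 'g \<Rightarrow> 'c" +
  assumes map_act: "\<lbrakk>c \<in> arr C; a \<in> arr G; tgt C c = src G a\<rbrakk>
          \<Longrightarrow> \<delta> (act c a) = \<boxminus>\<^bsub>G\<^esub> a \<boxplus>\<^bsub>G\<^esub> \<delta> c \<boxplus>\<^bsub>G\<^esub> a"
    and peiffer: "\<lbrakk>c \<in> arr C; d \<in> arr C; tgt C c = tgt C d\<rbrakk>
          \<Longrightarrow> act c (\<delta> d) = \<boxminus>\<^bsub>C\<^esub> d \<boxplus>\<^bsub>C\<^esub> c \<boxplus>\<^bsub>C\<^esub> d"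

locale crossed_module_groups =
  M: group M + P: group P
  for M :: "('m, 'k) monoid_scheme" and P :: "('p, 'l) monoid_scheme" +
  fixes \<mu> :: "'m \<Rightarrow> 'p" and act :: "'m \<Rightarrow> 'p \<Rightarrow> 'm"
  assumes map_hom: "\<mu> \<in> hom M P"
    and act_automorphism: "p \<in> carrier P \<Longrightarrow> (\<lambda>m. act m p) \<in> iso M M"
    and act_one: "m \<in> carrier M \<Longrightarrow> act m \<one>\<^bsub>P\<^esub> = m"
    and act_mult: "\<lbrakk>m \<in> carrier M; p \<in> carrier P; q \<in> carrier P\<rbrakk>
          \<Longrightarrow> act m (p \<otimes>\<^bsub>P\<^esub> q) = act (act m p) q"
    and map_act: "\<lbrakk>m \<in> carrier M; p \<in> carrier P\<rbrakk>
          \<Longrightarrow> \<mu> (act m p) = inv\<^bsub>P\<^esub> p \<otimes>\<^bsub>P\<^esub> \<mu> m \<otimes>\<^bsub>P\<^esub> p"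
    and peiffer: "\<lbrakk>m \<in> carrier M; m' \<in> carrier M\<rbrakk>
          \<Longrightarrow> act m (\<mu> m') = inv\<^bsub>M\<^esub> m' \<otimes>\<^bsub>M\<^esub> m \<otimes>\<^bsub>M\<^esub> m'"


section \<open>Free derivations and sections\<close>

text \<open>
  Functions on the object set or on the arrows of \<open>G\<close> are represented by extensional functions
  (undefined outside their domain), so that equality in the carriers below is equality of
  functions on the intended domain.
\<close>

definition free_derivations ::
  "('x, 'c) groupoid_data \<Rightarrow> ('x, 'g) groupoid_data \<Rightarrow> ('c \<Rightarrow> 'g \<Rightarrow> 'c)
    \<Rightarrow> (('x \<Rightarrow> 'g) \<times> ('g \<Rightarrow> 'c)) set" where
  "free_derivations C G act =
    {(s0, s1). s0 \<in> obj G \<rightarrow>\<^sub>E arr G \<and> s1 \<in> arr G \<rightarrow>\<^sub>E arr C \<and>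
       (\<forall>x\<in>obj G. tgt G (s0 x) = x) \<and>
       (\<forall>a\<in>arr G. tgt C (s1 a) = tgt G a) \<and>
       (\<forall>a\<in>arr G. \<forall>b\<in>arr G. tgt G a = src G b \<longrightarrow>
          s1 (a \<boxplus>\<^bsub>G\<^esub> b) = act (s1 a) b \<boxplus>\<^bsub>C\<^esub> s1 b)}"

text \<open>The object map \<open>g0\<close> and the arrow map \<open>g1\<close> determined by a free derivation \<open>(t0, t1)\<close>.\<close>

definition fder_obj ::
  "('x, 'g) groupoid_data \<Rightarrow> ('x \<Rightarrow> 'g) \<times> ('g \<Rightarrow> 'c) \<Rightarrow> 'x \<Rightarrow> 'x" where
  "fder_obj G = (\<lambda>(t0, t1) x. src G (t0 x))"

definition fder_arr ::
  "('x, 'g) groupoid_data \<Rightarrow> ('c \<Rightarrow> 'g) \<Rightarrow> ('x \<Rightarrow> 'g) \<times> ('g \<Rightarrow> 'c) \<Rightarrow> 'g \<Rightarrow> 'g" where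
  "fder_arr G \<delta> = (\<lambda>(t0, t1) a.
     t0 (src G a) \<boxplus>\<^bsub>G\<^esub> a \<boxplus>\<^bsub>G\<^esub> \<delta> (t1 a) \<boxplus>\<^bsub>G\<^esub> \<boxminus>\<^bsub>G\<^esub> t0 (tgt G a))"

definition fder_mult ::
  "('x, 'c) groupoid_data \<Rightarrow> ('x, 'g) groupoid_data \<Rightarrow> ('c \<Rightarrow> 'g) \<Rightarrow> ('c \<Rightarrow> 'g \<Rightarrow> 'c)
    \<Rightarrow> ('x \<Rightarrow> 'g) \<times> ('g \<Rightarrow> 'c) \<Rightarrow> ('x \<Rightarrow> 'g) \<times> ('g \<Rightarrow> 'c) \<Rightarrow> ('x \<Rightarrow> 'g) \<times> ('g \<Rightarrow> 'c)" where
  "fder_mult C G \<delta> act s t =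
    (\<lambda>x\<in>obj G. fst s (fder_obj G t x) \<boxplus>\<^bsub>G\<^esub> fst t x,
     \<lambda>a\<in>arr G. snd t a \<boxplus>\<^bsub>C\<^esub> act (snd s (fder_arr G \<delta> t a)) (fst t (tgt G a)))"

definition FDer ::
  "('x, 'c) groupoid_data \<Rightarrow> ('x, 'g) groupoid_data \<Rightarrow> ('c \<Rightarrow> 'g) \<Rightarrow> ('c \<Rightarrow> 'g \<Rightarrow> 'c)
    \<Rightarrow> (('x \<Rightarrow> 'g) \<times> ('g \<Rightarrow> 'c)) monoid" where
  "FDer C G \<delta> act =
    \<lparr>carrier = free_derivations C G act,
     mult = fder_mult C G \<delta> act,
     one = (\<lambda>x\<in>obj G. gid G x, \<lambda>a\<in>arr G. gid C (tgt G a))\<rparr>"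

definition FDer_star ::
  "('x, 'c) groupoid_data \<Rightarrow> ('x, 'g) groupoid_data \<Rightarrow> ('c \<Rightarrow> 'g) \<Rightarrow> ('c \<Rightarrow> 'g \<Rightarrow> 'c)
    \<Rightarrow> (('x \<Rightarrow> 'g) \<times> ('g \<Rightarrow> 'c)) monoid" where
  "FDer_star C G \<delta> act = units_of (FDer C G \<delta> act)"

definition M2 :: "('x, 'c) groupoid_data \<Rightarrow> ('x \<Rightarrow> 'c) monoid" where
  "M2 C =
    \<lparr>carrier = {s \<in> obj C \<rightarrow>\<^sub>E arr C. \<forall>x\<in>obj C. tgt C (s x) = x},
     mult = (\<lambda>s t. \<lambda>x\<in>obj C. s x \<boxplus>\<^bsub>C\<^esub> t x),
     one = (\<lambda>x\<in>obj C. gid C x)\<rparr>"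

definition zeta ::
  "('x, 'c) groupoid_data \<Rightarrow> ('x, 'g) groupoid_data \<Rightarrow> ('c \<Rightarrow> 'g) \<Rightarrow> ('c \<Rightarrow> 'g \<Rightarrow> 'c)
    \<Rightarrow> ('x \<Rightarrow> 'c) \<Rightarrow> ('x \<Rightarrow> 'g) \<times> ('g \<Rightarrow> 'c)" where
  "zeta C G \<delta> act s =
    (\<lambda>x\<in>obj G. \<delta> (s x),
     \<lambda>a\<in>arr G. \<boxminus>\<^bsub>C\<^esub> (act (s (src G a)) a) \<boxplus>\<^bsub>C\<^esub> s (tgt G a))"

definition M2_act ::
  "('x, 'g) groupoid_data \<Rightarrow> ('c \<Rightarrow> 'g \<Rightarrow> 'c)
    \<Rightarrow> ('x \<Rightarrow> 'c) \<Rightarrow> ('x \<Rightarrow> 'g) \<times> ('g \<Rightarrow> 'c) \<Rightarrow> ('x \<Rightarrow> 'c)" where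
  "M2_act G act s = (\<lambda>(t0, t1). \<lambda>x\<in>obj G. act (s (src G (t0 x))) (t0 x))"

end

theory Submission
  imports Defs
begin

text \<open>
  The arrow map \<open>g\<^sub>1\<close> of a free derivation \<open>t\<close> satisfies
  \<open>g\<^sub>1 a + t\<^sub>0(\<beta> a) = t\<^sub>0(\<alpha> a) + a + \<delta> t\<^sub>1(a)\<close>.  By the Peiffer law, acting by this element is
  acting by \<open>t\<^sub>0(\<alpha> a)\<close>, then by \<open>a\<close>, and then conjugating by \<open>t\<^sub>1(a)\<close>; the factors \<open>t\<^sub>1(a)\<close> cancel in
  the product formula.  This gives closure of \<open>FDer\<close> under multiplication, and, in the form
  \<open>t * \<zeta>(s\<^sup>t) = \<zeta>(s) * t\<close>, which needs no description of inverses in \<open>FDer\<^sup>*\<close>, equivariance of \<open>\<zeta>\<close>.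
  Since \<open>\<zeta>(s)\<close> has trivial \<open>g\<^sub>0\<close> and \<open>g\<^sub>1\<close>, the map \<open>\<zeta>\<close> is multiplicative, and hence its values
  are invertible, because sections are.
\<close>

section \<open>Inverses and cancellation in a groupoid\<close>

context groupoid
begin

lemmas basic_simps [simp] = src_obj tgt_obj gid_arr src_gid tgt_gid gplus_arr src_gplus tgt_gplus
  gplus_assoc gid_left gid_right

text \<open>Both sides equal \<open>c \<boxplus> a \<boxplus> b\<close>. This makes the description
  in \<open>gneg_def\<close> well defined.\<close>

lemma left_inverse_unique:
  assumes "a \<in> arr G" "b \<in> arr G" "c \<in> arr G" "src G b = tgt G a"
    and "tgt G c = src G a"
    and "a \<boxplus> b = gid G (src G a)" "c \<boxplus> a = gid G (tgt G a)"
  shows "b = c"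
  by (metis assms gid_left gid_right gplus_assoc)

lemma gneg_props:
  assumes a: "a \<in> arr G"
  shows "\<boxminus> a \<in> arr G \<and> src G (\<boxminus> a) = tgt G a \<and> tgt G (\<boxminus> a) = src G a \<and>
    a \<boxplus> \<boxminus> a = gid G (src G a) \<and> \<boxminus> a \<boxplus> a = gid G (tgt G a)"
  unfolding gneg_def
proof (rule theI')
  show "\<exists>!b. b \<in> arr G \<and> src G b = tgt G a \<and> tgt G b = src G a \<and>
    a \<boxplus> b = gid G (src G a) \<and> b \<boxplus> a = gid G (tgt G a)"
    using inverse_ex[OF a] left_inverse_unique[OF a] by (intro ex_ex1I) blast+
qed

lemma gneg_arr [simp]: "a \<in> arr G \<Longrightarrow> \<boxminus> a \<in> arr G"
  and src_gneg [simp]: "a \<in> arr G \<Longrightarrow> src G (\<boxminus> a) = tgt G a"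
  and tgt_gneg [simp]: "a \<in> arr G \<Longrightarrow> tgt G (\<boxminus> a) = src G a"
  and gplus_gneg [simp]: "a \<in> arr G \<Longrightarrow> a \<boxplus> \<boxminus> a = gid G (src G a)"
  and gneg_gplus_self [simp]: "a \<in> arr G \<Longrightarrow> \<boxminus> a \<boxplus> a = gid G (tgt G a)"
  using gneg_props by blast+

lemma gid_gplus [simp]: "\<lbrakk>b \<in> arr G; src G b = x\<rbrakk> \<Longrightarrow> gid G x \<boxplus> b = b"
  and gplus_gid [simp]: "\<lbrakk>a \<in> arr G; tgt G a = x\<rbrakk> \<Longrightarrow> a \<boxplus> gid G x = a"
  by auto

lemma gplus_gneg_cancel [simp]:
  "\<lbrakk>a \<in> arr G; b \<in> arr G; src G b = src G a\<rbrakk> \<Longrightarrow> a \<boxplus> (\<boxminus> a \<boxplus> b) = b"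
  by (simp flip: gplus_assoc)

lemma gneg_gplus_cancel [simp]:
  "\<lbrakk>a \<in> arr G; b \<in> arr G; src G b = tgt G a\<rbrakk> \<Longrightarrow> \<boxminus> a \<boxplus> (a \<boxplus> b) = b"
  by (simp flip: gplus_assoc)

text \<open>Cancelling \<open>a\<close> on the left shows that a right inverse already determines
  \<open>\<boxminus> a\<close>, so later identifications of inverses check a single product.\<close>

lemma gneg_unique:
  assumes "a \<in> arr G" "b \<in> arr G" "tgt G a = src G b" "a \<boxplus> b = gid G (src G a)"
  shows "\<boxminus> a = b"
proof -
  have "\<boxminus> a = \<boxminus> a \<boxplus> (a \<boxplus> b)"
    using assms by simp
  then show ?thesis
    using assms(1-3) by simp
qed

lemma gneg_gneg [simp]: "a \<in> arr G \<Longrightarrow> \<boxminus> (\<boxminus> a) = a"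
  by (rule gneg_unique) simp_all

lemma gneg_gid [simp]: "x \<in> obj G \<Longrightarrow> \<boxminus> (gid G x) = gid G x"
  by (rule gneg_unique) simp_all

lemma gneg_gplus [simp]:
  "\<lbrakk>a \<in> arr G; b \<in> arr G; tgt G a = src G b\<rbrakk> \<Longrightarrow> \<boxminus> (a \<boxplus> b) = \<boxminus> b \<boxplus> \<boxminus> a"
  by (rule gneg_unique) simp_all

lemma idem_gid:
  assumes "a \<in> arr G" "tgt G a = src G a" "a \<boxplus> a = a"
  shows "a = gid G (tgt G a)"
proof -
  have "\<boxminus> a \<boxplus> (a \<boxplus> a) = a"
    using assms(1,2) by simp
  then show ?thesis
    using assms by simp
qed

end

section \<open>Derived laws of the boundary map and the action\<close>

context crossed_module_groupoids
begin

declare same_obj [simp] map_arr [simp] map_src [simp] map_tgt [simp] map_gid [simp] map_gplus [simp]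
  act_arr [simp] act_tgt [simp] act_gplus [simp] act_act [simp] map_act [simp] peiffer [simp]

lemma src_C [simp]: "c \<in> arr C \<Longrightarrow> src C c = tgt C c"
  using act_intransitive by (simp add: totally_intransitive_def)

lemma C_tgt_obj [simp]: "c \<in> arr C \<Longrightarrow> tgt C c \<in> obj G"
  using dom.tgt_obj by simp

lemma act_gid' [simp]: "\<lbrakk>c \<in> arr C; tgt C c = x\<rbrakk> \<Longrightarrow> act c (gid G x) = c"
  using act_gid by blast

lemma map_gneg [simp]: "c \<in> arr C \<Longrightarrow> \<delta> (\<boxminus>\<^bsub>C\<^esub> c) = \<boxminus>\<^bsub>G\<^esub> (\<delta> c)"
  by (rule cod.gneg_unique[symmetric]) (simp_all flip: map_gplus)

text \<open>Acting by \<open>a\<close> is additive, so the image of an identity is idempotent, and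
  an idempotent loop is an identity (\<open>idem_gid\<close>).\<close>

lemma gid_act [simp]:
  assumes "a \<in> arr G" "src G a = x"
  shows "act (gid C x) a = gid C (tgt G a)"
proof -
  have x: "x \<in> obj G"
    using assms by auto
  have "act (gid C x) a \<boxplus>\<^bsub>C\<^esub> act (gid C x) a = act (gid C x) a"
    using assms x by (simp flip: act_gplus)
  then show ?thesis
    using dom.idem_gid[of "act (gid C x) a"] assms x by simp
qed

lemma gneg_act [simp]:
  "\<lbrakk>c \<in> arr C; a \<in> arr G; tgt C c = src G a\<rbrakk> \<Longrightarrow> act (\<boxminus>\<^bsub>C\<^esub> c) a = \<boxminus>\<^bsub>C\<^esub> (act c a)"
  by (rule dom.gneg_unique[symmetric]) (simp_all flip: act_gplus)

text \<open>Absorbs the last summand of \<open>g t a\<close> when acting by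
  \<open>fst t (tgt G a)\<close> follows.\<close>

lemma act_gneg_cancel [simp]:
  assumes "c \<in> arr C" "a \<in> arr G" "tgt C c = tgt G a"
  shows "act (act c (\<boxminus>\<^bsub>G\<^esub> a)) a = c"
  using assms by (simp flip: act_act)

section \<open>Free derivations and their induced arrow maps\<close>

abbreviation "D \<equiv> free_derivations C G act"
abbreviation "g \<equiv> fder_arr G \<delta>"

lemma fder_simps [simp]:
  assumes "t \<in> D"
  shows "x \<in> obj G \<Longrightarrow> fst t x \<in> arr G"
    and "x \<in> obj G \<Longrightarrow> tgt G (fst t x) = x"
    and "a \<in> arr G \<Longrightarrow> snd t a \<in> arr C"
    and "a \<in> arr G \<Longrightarrow> tgt C (snd t a) = tgt G a"
    and "\<lbrakk>a \<in> arr G; b \<in> arr G; tgt G a = src G b\<rbrakk>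
      \<Longrightarrow> snd t (a \<boxplus>\<^bsub>G\<^esub> b) = act (snd t a) b \<boxplus>\<^bsub>C\<^esub> snd t b"
    and "x \<notin> obj G \<Longrightarrow> fst t x = undefined"
    and "a \<notin> arr G \<Longrightarrow> snd t a = undefined"
  using assms by (auto simp: free_derivations_def PiE_def extensional_def Pi_def)

text \<open>Off their domains both components are \<open>undefined\<close>, so agreement on objects
  and arrows is enough.\<close>

lemma fder_eqI:
  assumes "s \<in> D" "t \<in> D" "\<And>x. x \<in> obj G \<Longrightarrow> fst s x = fst t x"
    and "\<And>a. a \<in> arr G \<Longrightarrow> snd s a = snd t a"
  shows "s = t"
proof (rule prod_eqI)
  show "fst s = fst t" "snd s = snd t"
    using assms fder_simps(6,7) by (metis ext)+
qed

lemma fder_obj_eq [simp]: "fder_obj G t x = src G (fst t x)"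
  by (simp add: fder_obj_def split: prod.split)

lemma fder_arr_eq: "g t a = fst t (src G a) \<boxplus>\<^bsub>G\<^esub> a \<boxplus>\<^bsub>G\<^esub> \<delta> (snd t a) \<boxplus>\<^bsub>G\<^esub> \<boxminus>\<^bsub>G\<^esub> fst t (tgt G a)"
  by (simp add: fder_arr_def split: prod.split)

lemma fder_arr_simps [simp]:
  assumes "t \<in> D" "a \<in> arr G"
  shows "g t a \<in> arr G" "src G (g t a) = src G (fst t (src G a))"
    "tgt G (g t a) = src G (fst t (tgt G a))"
  using assms by (simp_all add: fder_arr_eq)

lemma fder_arr_gplus [simp]:
  assumes "t \<in> D" "a \<in> arr G" "b \<in> arr G" "tgt G a = src G b"
  shows "g t (a \<boxplus>\<^bsub>G\<^esub> b) = g t a \<boxplus>\<^bsub>G\<^esub> g t b"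
  using assms by (simp add: fder_arr_eq)

text \<open>The Peiffer law turns the summand \<open>\<delta> (snd t a)\<close> of
  \<open>g t a\<close> into conjugation by \<open>snd t a\<close>. The right-nested sum lets
  \<open>gneg_gplus_cancel\<close> and its companion remove the outer terms in products.\<close>

lemma act_fder_arr:
  assumes "t \<in> D" "a \<in> arr G" "c \<in> arr C" "tgt C c = src G (fst t (src G a))"
  shows "act (act c (g t a)) (fst t (tgt G a)) =
    \<boxminus>\<^bsub>C\<^esub> (snd t a) \<boxplus>\<^bsub>C\<^esub> (act (act c (fst t (src G a))) a \<boxplus>\<^bsub>C\<^esub> snd t a)"
  using assms by (simp add: fder_arr_eq)

abbreviation fmult (infixl "\<star>" 70) where "s \<star> t \<equiv> fder_mult C G \<delta> act s t"

lemma fst_fmult [simp]: "x \<in> obj G \<Longrightarrow> fst (s \<star> t) x = fst s (src G (fst t x)) \<boxplus>\<^bsub>G\<^esub> fst t x"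
  by (simp add: fder_mult_def)

lemma snd_fmult [simp]:
  "a \<in> arr G \<Longrightarrow> snd (s \<star> t) a = snd t a \<boxplus>\<^bsub>C\<^esub> act (snd s (g t a)) (fst t (tgt G a))"
  by (simp add: fder_mult_def)

lemma fderI:
  assumes "\<And>x. x \<in> obj G \<Longrightarrow> fst t x \<in> arr G \<and> tgt G (fst t x) = x"
    and "\<And>a. a \<in> arr G \<Longrightarrow> snd t a \<in> arr C \<and> tgt C (snd t a) = tgt G a"
    and "\<And>a b. \<lbrakk>a \<in> arr G; b \<in> arr G; tgt G a = src G b\<rbrakk>
      \<Longrightarrow> snd t (a \<boxplus>\<^bsub>G\<^esub> b) = act (snd t a) b \<boxplus>\<^bsub>C\<^esub> snd t b"
    and "fst t \<in> extensional (obj G)" "snd t \<in> extensional (arr G)"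
  shows "t \<in> D"
  using assms by (auto simp: free_derivations_def PiE_def split: prod.split)

lemma fmult_closed [simp]:
  assumes s: "s \<in> D" and t: "t \<in> D"
  shows "s \<star> t \<in> D"
proof (rule fderI)
  fix a b
  assume "a \<in> arr G" "b \<in> arr G" "tgt G a = src G b"
  then show "snd (s \<star> t) (a \<boxplus>\<^bsub>G\<^esub> b) = act (snd (s \<star> t) a) b \<boxplus>\<^bsub>C\<^esub> snd (s \<star> t) b"
    using s t by (simp add: act_fder_arr)
qed (use s t in \<open>simp_all add: fder_mult_def\<close>)

text \<open>In \<open>\<delta> (snd (s \<star> t) a)\<close> the summand from \<open>s\<close> is
  conjugated by \<open>fst t (tgt G a)\<close>, and the negative of
  \<open>fst (s \<star> t) (tgt G a)\<close> cancels the trailing conjugator.\<close>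

lemma fder_arr_fmult [simp]:
  assumes "s \<in> D" "t \<in> D" "a \<in> arr G"
  shows "g (s \<star> t) a = g s (g t a)"
proof -
  have "g (s \<star> t) a = fst s (src G (fst t (src G a))) \<boxplus>\<^bsub>G\<^esub> (g t a \<boxplus>\<^bsub>G\<^esub> (\<delta> (snd s (g t a))
    \<boxplus>\<^bsub>G\<^esub> \<boxminus>\<^bsub>G\<^esub> fst s (src G (fst t (tgt G a)))))"
    \<comment> \<open>Only \<open>g (s \<star> t) a\<close> and the free-standing
      \<open>g t a\<close> are unfolded; the argument of \<open>snd s\<close> stays folded.\<close>
    using assms by (subst (1 2) fder_arr_eq) simp
  also have "\<dots> = g s (g t a)"
    using assms by (subst (3) fder_arr_eq) simp
  finally show ?thesis .
qed

section \<open>The monoid of free derivations and its unit group\<close>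

abbreviation "unit_fder \<equiv> (\<lambda>x\<in>obj G. gid G x, \<lambda>a\<in>arr G. gid C (tgt G a))"

lemma unit_fder_closed [simp]: "unit_fder \<in> D"
  by (rule fderI) simp_all

lemma fder_arr_unit [simp]: "a \<in> arr G \<Longrightarrow> g unit_fder a = a"
  by (simp add: fder_arr_eq)

lemma monoid_FDer: "monoid (FDer C G \<delta> act)"
proof (rule monoidI, unfold FDer_def monoid.simps partial_object.simps)
  fix s t assume "s \<in> D" "t \<in> D"
  then show "s \<star> t \<in> D" by simp
next
  fix r s t assume D: "r \<in> D" "s \<in> D" "t \<in> D"
  show "r \<star> s \<star> t = r \<star> (s \<star> t)"
    \<comment> \<open>By \<open>fder_arr_fmult\<close>, both bracketings evaluate
      \<open>snd r\<close> at \<open>g s (g t a)\<close>.\<close>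
    by (rule fder_eqI) (use D in simp_all)
next
  fix t assume "t \<in> D"
  then show "unit_fder \<star> t = t" "t \<star> unit_fder = t"
    by (auto intro!: fder_eqI)
qed simp

interpretation FD: monoid "FDer C G \<delta> act"
  by (rule monoid_FDer)

abbreviation "P \<equiv> FDer_star C G \<delta> act"

lemma group_FDer_star: "group P"
  unfolding FDer_star_def by (rule FD.units_group)

lemma FDer_simps [simp]:
  "carrier (FDer C G \<delta> act) = D"
  "mult (FDer C G \<delta> act) = fder_mult C G \<delta> act"
  "one (FDer C G \<delta> act) = unit_fder"
  by (simp_all add: FDer_def)

lemma FDer_star_simps [simp]:
  "mult P = fder_mult C G \<delta> act" "one P = unit_fder"
  by (simp_all add: FDer_star_def units_of_def)

lemma FDer_star_carrier:
  "t \<in> carrier P \<longleftrightarrow> t \<in> D \<and> (\<exists>s\<in>D. s \<star> t = unit_fder \<and> t \<star> s = unit_fder)"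
  by (auto simp: FDer_star_def units_of_def Units_def)

section \<open>The group of sections\<close>

abbreviation "S \<equiv> carrier (M2 C)"

lemma section_eqI:
  assumes "s \<in> S" "t \<in> S" "\<And>x. x \<in> obj G \<Longrightarrow> s x = t x"
  shows "s = t"
  by (rule PiE_ext[of _ "obj C" "\<lambda>_. arr C"]) (use assms in \<open>simp_all add: M2_def\<close>)

lemma sectionI:
  assumes "\<And>x. x \<in> obj G \<Longrightarrow> s x \<in> arr C \<and> tgt C (s x) = x" "s \<in> extensional (obj G)"
  shows "s \<in> S"
  using assms by (simp add: M2_def PiE_def Pi_def)

lemma M2_mult_apply [simp]: "x \<in> obj G \<Longrightarrow> (s \<otimes>\<^bsub>M2 C\<^esub> t) x = s x \<boxplus>\<^bsub>C\<^esub> t x"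
  and M2_one_apply [simp]: "x \<in> obj G \<Longrightarrow> \<one>\<^bsub>M2 C\<^esub> x = gid C x"
  by (simp_all add: M2_def)

lemma M2_extensional [simp]:
  "s \<otimes>\<^bsub>M2 C\<^esub> t \<in> extensional (obj G)" "\<one>\<^bsub>M2 C\<^esub> \<in> extensional (obj G)"
  by (simp_all add: M2_def)

(* Not available as rewrite rules earlier: together with M2_def they make the simplifier loop. *)
lemma section_simps [simp]:
  assumes "s \<in> S" "x \<in> obj G"
  shows "s x \<in> arr C" "tgt C (s x) = x"
  using assms PiE_mem[of s "obj C" "\<lambda>_. arr C"] by (simp_all add: M2_def)

lemma M2_closed [simp]:
  "\<lbrakk>s \<in> S; t \<in> S\<rbrakk> \<Longrightarrow> s \<otimes>\<^bsub>M2 C\<^esub> t \<in> S" "\<one>\<^bsub>M2 C\<^esub> \<in> S"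
  by (rule sectionI; simp)+

text \<open>An explicit inverse that can be evaluated at objects, unlike the abstract
  \<open>inv\<close>; \<open>M2_inv\<close> identifies the two.\<close>

definition sneg :: "('x \<Rightarrow> 'c) \<Rightarrow> 'x \<Rightarrow> 'c" where
  "sneg s = (\<lambda>x\<in>obj G. \<boxminus>\<^bsub>C\<^esub> (s x))"

lemma sneg_closed [simp]: "s \<in> S \<Longrightarrow> sneg s \<in> S"
  by (rule sectionI) (simp_all add: sneg_def)

lemma sneg_left [simp]: "s \<in> S \<Longrightarrow> sneg s \<otimes>\<^bsub>M2 C\<^esub> s = \<one>\<^bsub>M2 C\<^esub>"
  and sneg_right [simp]: "s \<in> S \<Longrightarrow> s \<otimes>\<^bsub>M2 C\<^esub> sneg s = \<one>\<^bsub>M2 C\<^esub>"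
  by (rule section_eqI, simp, simp, simp add: sneg_def)+

lemma group_M2: "group (M2 C)"
proof (rule groupI)
  fix r s t assume S: "r \<in> S" "s \<in> S" "t \<in> S"
  show "r \<otimes>\<^bsub>M2 C\<^esub> s \<otimes>\<^bsub>M2 C\<^esub> t = r \<otimes>\<^bsub>M2 C\<^esub> (s \<otimes>\<^bsub>M2 C\<^esub> t)"
    by (rule section_eqI) (use S in simp_all)
next
  fix s assume s: "s \<in> S"
  show "\<one>\<^bsub>M2 C\<^esub> \<otimes>\<^bsub>M2 C\<^esub> s = s"
    by (rule section_eqI) (use s in simp_all)
  show "\<exists>t\<in>S. t \<otimes>\<^bsub>M2 C\<^esub> s = \<one>\<^bsub>M2 C\<^esub>"
    using s by (intro bexI[of _ "sneg s"]) simp_all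
qed simp_all

lemma M2_inv: "s \<in> S \<Longrightarrow> inv\<^bsub>M2 C\<^esub> s = sneg s"
  by (rule group.inv_equality[OF group_M2]) simp_all

section \<open>The homomorphism from sections to invertible derivations\<close>

abbreviation "\<zeta> \<equiv> zeta C G \<delta> act"

lemma fst_zeta [simp]: "x \<in> obj G \<Longrightarrow> fst (\<zeta> s) x = \<delta> (s x)"
  by (simp add: zeta_def)

lemma snd_zeta [simp]:
  "a \<in> arr G \<Longrightarrow> snd (\<zeta> s) a = \<boxminus>\<^bsub>C\<^esub> (act (s (src G a)) a) \<boxplus>\<^bsub>C\<^esub> s (tgt G a)"
  by (simp add: zeta_def)

lemma zeta_closed_D [simp]:
  assumes "s \<in> S"
  shows "\<zeta> s \<in> D"
  by (rule fderI) (use assms in simp_all, simp_all add: zeta_def)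

text \<open>Since \<open>\<delta> (act (s (src G a)) a)\<close> is the conjugate of
  \<open>\<delta> (s (src G a))\<close> by \<open>a\<close>, its negative in the third summand
  cancels the first two up to \<open>a\<close>; the terms at \<open>tgt G a\<close> cancel each
  other.\<close>

lemma fder_arr_zeta [simp]:
  assumes "s \<in> S" "a \<in> arr G"
  shows "g (\<zeta> s) a = a"
  using assms by (simp add: fder_arr_eq)

text \<open>With \<open>g (\<zeta> t) a = a\<close>, the factor from \<open>s\<close> is acted on by
  \<open>\<delta> (t (tgt G a))\<close>. By Peiffer this is conjugation by
  \<open>t (tgt G a)\<close>, which moves the \<open>t\<close> terms to the outside.\<close>

lemma zeta_mult:
  assumes "s \<in> S" "t \<in> S"
  shows "\<zeta> (s \<otimes>\<^bsub>M2 C\<^esub> t) = \<zeta> s \<star> \<zeta> t"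
  by (rule fder_eqI) (use assms in simp_all)

lemma zeta_one: "\<zeta> \<one>\<^bsub>M2 C\<^esub> = unit_fder"
  by (rule fder_eqI) simp_all

lemma zeta_closed [simp]:
  assumes "s \<in> S"
  shows "\<zeta> s \<in> carrier P"
  using assms zeta_mult[of s "sneg s"] zeta_mult[of "sneg s" s]
  by (auto simp: FDer_star_carrier zeta_one intro!: bexI[of _ "\<zeta> (sneg s)"])

section \<open>The action of free derivations on sections\<close>

abbreviation "sact \<equiv> M2_act G act"

lemma sact_apply [simp]: "x \<in> obj G \<Longrightarrow> sact s t x = act (s (src G (fst t x))) (fst t x)"
  by (simp add: M2_act_def split: prod.split)

lemma sact_closed [simp]:
  assumes "s \<in> S" "t \<in> D"
  shows "sact s t \<in> S"
  by (rule sectionI) (use assms in simp_all, simp add: M2_act_def split: prod.split)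

lemma sact_hom:
  assumes "s \<in> S" "s' \<in> S" "t \<in> D"
  shows "sact (s \<otimes>\<^bsub>M2 C\<^esub> s') t = sact s t \<otimes>\<^bsub>M2 C\<^esub> sact s' t"
  by (rule section_eqI) (use assms in simp_all)

lemma sact_unit: "s \<in> S \<Longrightarrow> sact s unit_fder = s"
  by (rule section_eqI) simp_all

lemma sact_fmult:
  assumes "s \<in> S" "t \<in> D" "u \<in> D"
  shows "sact s (t \<star> u) = sact (sact s t) u"
  by (rule section_eqI) (use assms in simp_all)

text \<open>On an arrow \<open>a\<close> both sides reduce to -X + \<open>snd t a\<close> + Y, where
  X is \<open>act (sact s t (src G a)) a\<close> and Y is \<open>sact s t (tgt G a)\<close>.\<close>

lemma zeta_sact:
  assumes "s \<in> S" "t \<in> D"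
  shows "t \<star> \<zeta> (sact s t) = \<zeta> s \<star> t"
  by (rule fder_eqI) (use assms in \<open>simp_all add: act_fder_arr\<close>)

text \<open>The arrow \<open>\<delta> (s' x)\<close> is a loop at \<open>x\<close>, so this is the
  Peiffer law of the groupoids at each object.\<close>

lemma sact_zeta:
  assumes "s \<in> S" "s' \<in> S"
  shows "sact s (\<zeta> s') = inv\<^bsub>M2 C\<^esub> s' \<otimes>\<^bsub>M2 C\<^esub> s \<otimes>\<^bsub>M2 C\<^esub> s'"
  by (rule section_eqI) (use assms in \<open>simp_all add: M2_inv\<close>, simp add: sneg_def)

lemma sact_iso:
  assumes "t \<in> carrier P"
  shows "(\<lambda>s. sact s t) \<in> iso (M2 C) (M2 C)"
proof -
  obtain u where t: "t \<in> D" and u: "u \<in> D" "u \<star> t = unit_fder" "t \<star> u = unit_fder"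
    using assms by (auto simp: FDer_star_carrier)
  have "bij_betw (\<lambda>s. sact s t) S S"
    \<comment> \<open>The inverse map is the action of the inverse derivation \<open>u\<close>: both
      composites are the action of \<open>unit_fder\<close>.\<close>
    by (rule bij_betw_byWitness[where f' = "\<lambda>s. sact s u"])
      (use t u in \<open>auto simp: sact_unit simp flip: sact_fmult\<close>)
  then show ?thesis
    using t by (auto simp: iso_def hom_def sact_hom)
qed

section \<open>The crossed module of sections and invertible derivations\<close>

lemma crossed_module_zeta: "crossed_module_groups (M2 C) P \<zeta> sact"
proof -
  interpret M: group "M2 C" by (rule group_M2)
  interpret P: group P by (rule group_FDer_star)
  show ?thesis
  proof unfold_locales
    show "\<zeta> \<in> hom (M2 C) P"
      by (simp add: hom_def zeta_mult)
  next
    fix s t assume s: "s \<in> S" and t: "t \<in> carrier P"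
    then have "t \<in> D" by (simp add: FDer_star_carrier)
    \<comment> \<open>The inverse-free identity holds for every derivation; once all its terms lie
      in the group \<open>P\<close>, \<open>t\<close> can be moved across.\<close>
    then have "t \<otimes>\<^bsub>P\<^esub> \<zeta> (sact s t) = \<zeta> s \<otimes>\<^bsub>P\<^esub> t" "\<zeta> (sact s t) \<in> carrier P"
      using zeta_sact s by simp_all
    then show "\<zeta> (sact s t) = inv\<^bsub>P\<^esub> t \<otimes>\<^bsub>P\<^esub> \<zeta> s \<otimes>\<^bsub>P\<^esub> t"
      by (metis P.inv_closed P.inv_solve_left P.m_assoc P.m_closed s t zeta_closed)
  qed (auto simp: sact_iso sact_unit sact_fmult sact_zeta FDer_star_carrier)
qed

end

theorem theorem2p8:
  fixes C :: "('x, 'c) groupoid_data"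
    and G :: "('x, 'g) groupoid_data"
    and \<delta> :: "'c \<Rightarrow> 'g"
    and act :: "'c \<Rightarrow> 'g \<Rightarrow> 'c"
  assumes "crossed_module_groupoids C G \<delta> act"
  shows "crossed_module_groups (M2 C) (FDer_star C G \<delta> act) (zeta C G \<delta> act) (M2_act G act)"
  using assms by (rule crossed_module_groupoids.crossed_module_zeta)

end
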